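(* Let $\mathcal T$ be a basic theory and $\zeta\Rightarrow_r\eta$ a graded implication. If there is a forest proof of $\zeta\Rightarrow_r\eta$ from $\mathcal T$, then $\mathcal T\vdash\zeta\Rightarrow_r\eta$ in the calculus $\mathbf{LAE}$.
   Context: Boolean formulas are built from countably many variables and $\bot,\top$ via $\wedge,\vee,\neg$; $\alpha,\beta$ are Boolean equivalent if $\alpha\to\beta$ and $\beta\to\alpha$ are classical tautologies. A graded implication is $\alpha\Rightarrow_d\beta$, $d\in\mathbb R^+=[0,\infty)$. The calculus $\mathbf{LAE}$ has rules ($c,d\in\mathbb R^+$): (R1) $\alpha\Rightarrow_0\beta$ whenever $\alpha\to\beta$ is a classical tautology; (R2) from $\alpha\Rightarrow_0\beta$ infer $\alpha\wedge\gamma\Rightarrow_0\beta\wedge\gamma$; (R3) from $\alpha\Rightarrow_c\beta$ infer $\alpha\Rightarrow_d\beta$ for $d\ge c$; (R4) from $\alpha\Rightarrow_c\bot$ infer $\alpha\Rightarrow_0\bot$; (R5) from $\alpha\Rightarrow_c\gamma$ and $\beta\Rightarrow_c\gamma$ infer $\alpha\vee\beta\Rightarrow_c\gamma$; (R6) from $\alpha\Rightarrow_c\beta$ and $\beta\Rightarrow_d\gamma$ infer $\alpha\Rightarrow_{c+d}\gamma$. $\mathcal T\vdash\Phi$ means there is a finite sequence ending in $\Phi$ each member of which is in $\mathcal T$ or follows from earlier members by a rule. A literal is $\phi$ or $\neg\phi$ for a variable $\phi$; a clause is a finite set of literals, inconsistent if it contains some $\phi$ and $\neg\phi$, consistent otherwise;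 a clause set is a finite set of clauses. For a clause set $B$, $f(B)=\bigvee_{L\in B}\bigwedge L$ (empty conjunction $=\top$, empty disjunction $=\bot$); $B$ is a clause set for $\alpha$ if $f(B)$ is Boolean equivalent to $\alpha$. A basic implication is $\lambda_1\wedge\dots\wedge\lambda_n\Rightarrow_d\bigvee_{i=1}^l\bigwedge_{j=1}^{k_i}\mu_{ij}$ with $n\ge1$, $l\ge0$, $k_i\ge1$, where $\{\lambda_1,\dots,\lambda_n\}$ and all $\{\mu_{i1},\dots,\mu_{ik_i}\}$ are consistent clauses; a basic theory is a set of basic implications. A proof forest is a finite directed forest (each component a rooted tree, edges directed from father to child) with a weight in $\mathbb R^+$ on each edge, each node labelled by a clause or by the symbol $\divideontimes$ (nodes identified with labels; nodes not labelled $\divideontimes$ are proper). A branch is a maximal root-to-leaf path; its length is $0$ if it contains $\divideontimes$ and otherwise the sum of its edge weights; the length of the forest is the maximum length of its branches. A forest proof of $\zeta\Rightarrow_r\eta$ from a basic theory $\mathcal T$ is a proof forest such that: (T1) there is a clause set $B_\zeta$ for $\zeta$ such that each clause of $B_\zeta$ has a root that is a subset of it; (T2) there is a clause set $B_\eta$ for $\eta$ such that every terminal clause includes some clause of $B_\eta$; (T3) the length of the forest is at most $r$; (T4) for every non-terminal clause $L$, all edges from $L$ have the same weight $c$, and one of: (A) $c=0$ and $\mathcal T$ contains a basic implication $\lambda_1\wedge\dots\wedge\lambda_n\Rightarrow_0\bigvee_{i=1}^l\bigwedge_j\mu_{ij}$ with $\{\lambda_1,\dots,\lambda_n\}\subseteq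 L$ such that for each $i$ some child of $L$ is a clause $L'\subseteq\{\mu_{i1},\dots,\mu_{ik_i}\}\cup L$; (B) $c>0$ and $\mathcal T$ contains a basic implication $\lambda_1\wedge\dots\wedge\lambda_n\Rightarrow_c\bigvee_{i=1}^l\bigwedge_j\mu_{ij}$ with $\{\lambda_1,\dots,\lambda_n\}\subseteq L$ such that for each $i$ some child of $L$ is a clause $L'\subseteq\{\mu_{i1},\dots,\mu_{ik_i}\}$; (C) $c=0$, $L$ is inconsistent and $\divideontimes$ is the only child of $L$; (D) $c=0$ and for some variable $\phi$, $L$ has exactly two children, one consisting of $\phi$ together with a subset of $L$, the other of $\neg\phi$ together with a subset of $L$. *)

theory Defs
  imports Complex_Main
begin

datatype form =
    Var nat
  | Bot
  | Top
  | And form form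
  | Or form form
  | Neg form

abbreviation Imp :: "form \<Rightarrow> form \<Rightarrow> form" where
  "Imp \<alpha> \<beta> \<equiv> Or (Neg \<alpha>) \<beta>"

primrec holds :: "(nat \<Rightarrow> bool) \<Rightarrow> form \<Rightarrow> bool" where
  "holds v (Var p) = v p"
| "holds v Bot = False"
| "holds v Top = True"
| "holds v (And \<alpha> \<beta>) = (holds v \<alpha> \<and> holds v \<beta>)"
| "holds v (Or \<alpha> \<beta>) = (holds v \<alpha> \<or> holds v \<beta>)"
| "holds v (Neg \<alpha>) = (\<not> holds v \<alpha>)"

definition tautology :: "form \<Rightarrow> bool" where
  "tautology \<alpha> \<longleftrightarrow> (\<forall>v. holds v \<alpha>)"

definition bool_equiv :: "form \<Rightarrow> form \<Rightarrow> bool" where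
  "bool_equiv \<alpha> \<beta> \<longleftrightarrow> tautology (Imp \<alpha> \<beta>) \<and> tautology (Imp \<beta> \<alpha>)"

fun big_and :: "form list \<Rightarrow> form" where
  "big_and [] = Top"
| "big_and [\<alpha>] = \<alpha>"
| "big_and (\<alpha> # \<beta> # \<gamma>s) = And \<alpha> (big_and (\<beta> # \<gamma>s))"

fun big_or :: "form list \<Rightarrow> form" where
  "big_or [] = Bot"
| "big_or [\<alpha>] = \<alpha>"
| "big_or (\<alpha> # \<beta> # \<gamma>s) = Or \<alpha> (big_or (\<beta> # \<gamma>s))"


section \<open>Graded implications and the calculus LAE\<close>

text \<open>Degrees are reals; the restriction to $[0,\infty)$ is imposed wherever degrees are
  quantified: in the rules, in basic implications and on edge weights.\<close>

datatype gimp = GImp form real form  (\<open>(_ \<Rightarrow>[_] _)\<close> [61, 0, 61] 60)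

text \<open>\<open>lae_step P \<Phi>\<close>: \<open>\<Phi>\<close> follows by a single rule application whose premises all lie in \<open>P\<close>.\<close>

inductive lae_step :: "gimp set \<Rightarrow> gimp \<Rightarrow> bool" for P :: "gimp set" where
  R1: "tautology (Imp \<alpha> \<beta>) \<Longrightarrow> lae_step P (\<alpha> \<Rightarrow>[0] \<beta>)"
| R2: "(\<alpha> \<Rightarrow>[0] \<beta>) \<in> P \<Longrightarrow> lae_step P (And \<alpha> \<gamma> \<Rightarrow>[0] And \<beta> \<gamma>)"
| R3: "0 \<le> c \<Longrightarrow> c \<le> d \<Longrightarrow> (\<alpha> \<Rightarrow>[c] \<beta>) \<in> P \<Longrightarrow> lae_step P (\<alpha> \<Rightarrow>[d] \<beta>)"
| R4: "0 \<le> c \<Longrightarrow> (\<alpha> \<Rightarrow>[c] Bot) \<in> P \<Longrightarrow> lae_step P (\<alpha> \<Rightarrow>[0] Bot)"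
| R5: "0 \<le> c \<Longrightarrow> (\<alpha> \<Rightarrow>[c] \<gamma>) \<in> P \<Longrightarrow> (\<beta> \<Rightarrow>[c] \<gamma>) \<in> P \<Longrightarrow> lae_step P (Or \<alpha> \<beta> \<Rightarrow>[c] \<gamma>)"
| R6: "0 \<le> c \<Longrightarrow> 0 \<le> d \<Longrightarrow> (\<alpha> \<Rightarrow>[c] \<beta>) \<in> P \<Longrightarrow> (\<beta> \<Rightarrow>[d] \<gamma>) \<in> P
       \<Longrightarrow> lae_step P (\<alpha> \<Rightarrow>[c + d] \<gamma>)"

definition lae_proof :: "gimp set \<Rightarrow> gimp list \<Rightarrow> bool" where
  "lae_proof T \<Phi>s \<longleftrightarrow>
     (\<forall>i < length \<Phi>s. \<Phi>s ! i \<in> T \<or> lae_step (set (take i \<Phi>s)) (\<Phi>s ! i))"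

definition lae_proves :: "gimp set \<Rightarrow> gimp \<Rightarrow> bool"  (infix \<open>\<turnstile>\<close> 50) where
  "T \<turnstile> \<Phi> \<longleftrightarrow> (\<exists>\<Phi>s. \<Phi>s \<noteq> [] \<and> last \<Phi>s = \<Phi> \<and> lae_proof T \<Phi>s)"


section \<open>Clauses and basic theories\<close>

datatype lit = PosL nat | NegL nat

primrec lit_form :: "lit \<Rightarrow> form" where
  "lit_form (PosL p) = Var p"
| "lit_form (NegL p) = Neg (Var p)"

type_synonym clause = "lit set"

definition is_clause :: "clause \<Rightarrow> bool" where
  "is_clause L \<longleftrightarrow> finite L"

definition inconsistent :: "clause \<Rightarrow> bool" where
  "inconsistent L \<longleftrightarrow> (\<exists>p. PosL p \<in> L \<and> NegL p \<in> L)"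

definition is_clause_set :: "clause set \<Rightarrow> bool" where
  "is_clause_set B \<longleftrightarrow> finite B \<and> (\<forall>L\<in>B. is_clause L)"

text \<open>A fixed arbitrary enumeration of a finite set; its choice affects the formulas below
  only up to Boolean equivalence.\<close>

definition enum_list :: "'a set \<Rightarrow> 'a list" where
  "enum_list A = (SOME xs. distinct xs \<and> set xs = A)"

definition clause_form :: "clause \<Rightarrow> form" where
  "clause_form L = big_and (map lit_form (enum_list L))"

definition clause_set_form :: "clause set \<Rightarrow> form" where
  "clause_set_form B = big_or (map clause_form (enum_list B))"

definition clause_set_for :: "clause set \<Rightarrow> form \<Rightarrow> bool" where
  "clause_set_for B \<alpha> \<longleftrightarrow> is_clause_set B \<and> bool_equiv (clause_set_form B) \<alpha>"

text \<open>The list \<open>ls\<close> holds the literals $\lambda_1,\dots,\lambda_n$, the list \<open>mss\<close> the lists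
  $\mu_{i1},\dots,\mu_{ik_i}$ for $i=1,\dots,l$.\<close>

definition basic_gimp :: "lit list \<Rightarrow> real \<Rightarrow> lit list list \<Rightarrow> gimp" where
  "basic_gimp ls d mss =
     (big_and (map lit_form ls) \<Rightarrow>[d] big_or (map (\<lambda>ms. big_and (map lit_form ms)) mss))"

definition basic_data :: "lit list \<Rightarrow> real \<Rightarrow> lit list list \<Rightarrow> bool" where
  "basic_data ls d mss \<longleftrightarrow>
     0 \<le> d \<and> ls \<noteq> [] \<and> \<not> inconsistent (set ls) \<and>
     (\<forall>ms\<in>set mss. ms \<noteq> [] \<and> \<not> inconsistent (set ms))"

definition basic_implication :: "gimp \<Rightarrow> bool" where
  "basic_implication \<Phi> \<longleftrightarrow> (\<exists>ls d mss. basic_data ls d mss \<and> \<Phi> = basic_gimp ls d mss)"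

definition basic_theory :: "gimp set \<Rightarrow> bool" where
  "basic_theory T \<longleftrightarrow> (\<forall>\<Phi>\<in>T. basic_implication \<Phi>)"


section \<open>Proof forests\<close>

datatype label = Clause clause | Star

text \<open>A node carries its label and the list of its outgoing edges, each given by its weight and
  the subtree at the child. The order of children and of roots is irrelevant.\<close>

datatype ptree = Node (root_label: label) (edges: "(real \<times> ptree) list")

type_synonym pforest = "ptree list"

abbreviation child_labels :: "(real \<times> ptree) list \<Rightarrow> label list" where
  "child_labels es \<equiv> map (\<lambda>(w, t). root_label t) es"

text \<open>The nodes of a tree, each represented by the subtree hanging from it.\<close>

fun tree_nodes :: "ptree \<Rightarrow> ptree set" where
  "tree_nodes (Node a es) = insert (Node a es) (\<Union>(set (map (\<lambda>(w, t). tree_nodes t) es)))"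

definition forest_nodes :: "pforest \<Rightarrow> ptree set" where
  "forest_nodes F = (\<Union>t\<in>set F. tree_nodes t)"

definition proof_forest :: "pforest \<Rightarrow> bool" where
  "proof_forest F \<longleftrightarrow>
     (\<forall>a es. Node a es \<in> forest_nodes F \<longrightarrow>
        (\<forall>(w, t)\<in>set es. 0 \<le> w) \<and> (\<forall>L. a = Clause L \<longrightarrow> is_clause L))"

text \<open>A branch is given by the labels of its nodes and the weights of its edges, in order.\<close>

fun tree_branches :: "ptree \<Rightarrow> (label list \<times> real list) list" where
  "tree_branches (Node a es) =
     (if es = [] then [([a], [])]
      else concat (map (\<lambda>(w, t). map (\<lambda>(as, ws). (a # as, w # ws)) (tree_branches t)) es))"

definition branch_length :: "label list \<times> real list \<Rightarrow> real" where
  "branch_length b = (if Star \<in> set (fst b) then 0 else sum_list (snd b))"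

text \<open>Branch lengths are nonnegative, so inserting \<open>0\<close> only serves to give the empty forest
  length \<open>0\<close>.\<close>

definition forest_length :: "pforest \<Rightarrow> real" where
  "forest_length F = Max (insert 0 (branch_length ` (\<Union>t\<in>set F. set (tree_branches t))))"

definition case_A :: "gimp set \<Rightarrow> clause \<Rightarrow> real \<Rightarrow> (real \<times> ptree) list \<Rightarrow> bool" where
  "case_A T L c es \<longleftrightarrow> c = 0 \<and>
     (\<exists>ls mss. basic_data ls 0 mss \<and> basic_gimp ls 0 mss \<in> T \<and> set ls \<subseteq> L \<and>
        (\<forall>ms\<in>set mss. \<exists>L'. Clause L' \<in> set (child_labels es) \<and> L' \<subseteq> set ms \<union> L))"

definition case_B :: "gimp set \<Rightarrow> clause \<Rightarrow> real \<Rightarrow> (real \<times> ptree) list \<Rightarrow> bool" where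
  "case_B T L c es \<longleftrightarrow> c > 0 \<and>
     (\<exists>ls mss. basic_data ls c mss \<and> basic_gimp ls c mss \<in> T \<and> set ls \<subseteq> L \<and>
        (\<forall>ms\<in>set mss. \<exists>L'. Clause L' \<in> set (child_labels es) \<and> L' \<subseteq> set ms))"

definition case_C :: "clause \<Rightarrow> real \<Rightarrow> (real \<times> ptree) list \<Rightarrow> bool" where
  "case_C L c es \<longleftrightarrow> c = 0 \<and> inconsistent L \<and> child_labels es = [Star]"

definition case_D :: "clause \<Rightarrow> real \<Rightarrow> (real \<times> ptree) list \<Rightarrow> bool" where
  "case_D L c es \<longleftrightarrow> c = 0 \<and>
     (\<exists>p S1 S2. S1 \<subseteq> L \<and> S2 \<subseteq> L \<and>
        (child_labels es = [Clause (insert (PosL p) S1), Clause (insert (NegL p) S2)] \<or>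
         child_labels es = [Clause (insert (NegL p) S2), Clause (insert (PosL p) S1)]))"

definition forest_proof :: "gimp set \<Rightarrow> form \<Rightarrow> real \<Rightarrow> form \<Rightarrow> pforest \<Rightarrow> bool" where
  "forest_proof T \<zeta> r \<eta> F \<longleftrightarrow>
     proof_forest F \<and>
     (\<exists>B. clause_set_for B \<zeta> \<and> (\<forall>L\<in>B. \<exists>K. Clause K \<in> root_label ` set F \<and> K \<subseteq> L)) \<and>
     (\<exists>B. clause_set_for B \<eta> \<and>
        (\<forall>L. Node (Clause L) [] \<in> forest_nodes F \<longrightarrow> (\<exists>K\<in>B. K \<subseteq> L))) \<and>
     forest_length F \<le> r \<and>
     (\<forall>L es. Node (Clause L) es \<in> forest_nodes F \<and> es \<noteq> [] \<longrightarrow>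
        (\<exists>c. (\<forall>(w, t)\<in>set es. w = c) \<and>
             (case_A T L c es \<or> case_B T L c es \<or> case_C L c es \<or> case_D L c es)))"

end

theory Submission
  imports Defs
begin

text \<open>Let a graded implication \<open>\<alpha> \<Rightarrow>[r] \<eta>\<close> of negative degree mean that \<open>\<alpha>\<close> is refutable, that is,
  \<open>\<alpha> \<Rightarrow>[0] \<bottom>\<close>. Thanks to R4, rule R6 remains sound for this reading when its second premise has
  negative degree. Every inference of a proof forest derives, with the edge weight as degree, the
  disjunction of the children from the father. Induction from the leaves upwards therefore gives
  \<open>L \<Rightarrow>[r] \<eta>\<close> at a proper node \<open>L\<close> whenever \<open>r\<close> bounds the lengths of the branches from \<open>L\<close> that
  avoid the star symbol, an edge of weight \<open>c\<close> turning the bound \<open>r\<close> into \<open>r - c\<close>. A negative bound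
  is possible only at nodes all of whose branches run into the star symbol, and these nodes are
  refutable.\<close>

section \<open>Entailment between formulas and clauses\<close>

definition entails :: "form \<Rightarrow> form \<Rightarrow> bool"  (infix \<open>\<Turnstile>\<close> 50) where
  "\<alpha> \<Turnstile> \<beta> \<longleftrightarrow> (\<forall>v. holds v \<alpha> \<longrightarrow> holds v \<beta>)"

lemma entails_refl: "\<alpha> \<Turnstile> \<alpha>"
  by (simp add: entails_def)

lemma tautology_Imp_iff: "tautology (Imp \<alpha> \<beta>) \<longleftrightarrow> \<alpha> \<Turnstile> \<beta>"
  by (auto simp: tautology_def entails_def)

lemma bool_equiv_iff: "bool_equiv \<alpha> \<beta> \<longleftrightarrow> \<alpha> \<Turnstile> \<beta> \<and> \<beta> \<Turnstile> \<alpha>"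
  by (simp only: bool_equiv_def tautology_Imp_iff)

lemma holds_big_and [simp]: "holds v (big_and \<alpha>s) \<longleftrightarrow> (\<forall>\<alpha>\<in>set \<alpha>s. holds v \<alpha>)"
  by (induction \<alpha>s rule: big_and.induct) auto

lemma holds_big_or [simp]: "holds v (big_or \<alpha>s) \<longleftrightarrow> (\<exists>\<alpha>\<in>set \<alpha>s. holds v \<alpha>)"
  by (induction \<alpha>s rule: big_or.induct) auto

lemma set_enum_list [simp]:
  assumes "finite A"
  shows "set (enum_list A) = A"
  using someI_ex[OF finite_distinct_list[OF assms]] by (auto simp: enum_list_def conj_commute)

abbreviation literals_form :: "lit list \<Rightarrow> form" where
  "literals_form ls \<equiv> big_and (map lit_form ls)"

lemma holds_clause_form:
  "finite L \<Longrightarrow> holds v (clause_form L) \<longleftrightarrow> (\<forall>l\<in>L. holds v (lit_form l))"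
  by (simp add: clause_form_def)

lemma holds_clause_set_form:
  "finite B \<Longrightarrow> holds v (clause_set_form B) \<longleftrightarrow> (\<exists>L\<in>B. holds v (clause_form L))"
  by (simp add: clause_set_form_def)

lemma clause_set_for_finite: "clause_set_for B \<alpha> \<Longrightarrow> L \<in> B \<Longrightarrow> finite L"
  by (simp add: clause_set_for_def is_clause_set_def is_clause_def)

lemma holds_iff_clause_set_for:
  assumes "clause_set_for B \<alpha>"
  shows "holds v \<alpha> \<longleftrightarrow> (\<exists>L\<in>B. holds v (clause_form L))"
proof -
  have "finite B" and "holds v (clause_set_form B) \<longleftrightarrow> holds v \<alpha>"
    using assms
    by (auto simp: clause_set_for_def is_clause_set_def bool_equiv_iff entails_def)
  then show ?thesis by (simp add: holds_clause_set_form)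
qed

lemma clause_form_entails_subset:
  assumes "finite L" and "K \<subseteq> L"
  shows "clause_form L \<Turnstile> clause_form K"
  using assms finite_subset[OF assms(2,1)] by (auto simp: entails_def holds_clause_form)

lemma clause_form_entails_literals:
  assumes "finite L" and "set ls \<subseteq> L"
  shows "clause_form L \<Turnstile> literals_form ls"
  using assms by (auto simp: entails_def holds_clause_form)

lemma inconsistent_clause_form_entails:
  assumes "finite L" and "inconsistent L"
  shows "clause_form L \<Turnstile> \<alpha>"
proof -
  obtain p where "PosL p \<in> L" and "NegL p \<in> L"
    using assms(2) by (auto simp: inconsistent_def)
  then have "\<not> holds v (clause_form L)" for v
    using assms(1) by (metis holds.simps(6) holds_clause_form lit_form.simps)
  then show ?thesis by (simp add: entails_def)
qed

section \<open>Derivability in LAE\<close>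

lemma lae_step_mono:
  assumes "lae_step P \<Phi>" and "P \<subseteq> Q"
  shows "lae_step Q \<Phi>"
  using assms by (induction rule: lae_step.induct) (blast intro: lae_step.intros)+

lemma lae_step_finitary:
  assumes "lae_step P \<Phi>"
  obtains Q where "finite Q" and "Q \<subseteq> P" and "lae_step Q \<Phi>"
proof -
  have "\<exists>Q. finite Q \<and> Q \<subseteq> P \<and> lae_step Q \<Phi>"
    using assms
  proof cases
    case (R1 \<alpha> \<beta>)
    then show ?thesis by (intro exI[of _ "{}"]) (auto intro: lae_step.R1)
  next
    case (R2 \<alpha> \<beta> \<gamma>)
    then show ?thesis by (intro exI[of _ "{\<alpha> \<Rightarrow>[0] \<beta>}"]) (auto intro: lae_step.R2)
  next
    case (R3 c d \<alpha> \<beta>)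
    then show ?thesis by (intro exI[of _ "{\<alpha> \<Rightarrow>[c] \<beta>}"]) (auto intro: lae_step.R3)
  next
    case (R4 c \<alpha>)
    then show ?thesis by (intro exI[of _ "{\<alpha> \<Rightarrow>[c] Bot}"]) (auto intro: lae_step.R4)
  next
    case (R5 c \<alpha> \<gamma> \<beta>)
    then show ?thesis
      by (intro exI[of _ "{\<alpha> \<Rightarrow>[c] \<gamma>, \<beta> \<Rightarrow>[c] \<gamma>}"]) (auto intro: lae_step.R5)
  next
    case (R6 c d \<alpha> \<beta> \<gamma>)
    then show ?thesis
      by (intro exI[of _ "{\<alpha> \<Rightarrow>[c] \<beta>, \<beta> \<Rightarrow>[d] \<gamma>}"]) (auto intro: lae_step.R6)
  qed
  then show thesis using that by blast
qed

lemma lae_proof_Nil: "lae_proof T []"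
  by (simp add: lae_proof_def)

lemma lae_proof_snoc:
  "lae_proof T (\<Phi>s @ [\<Phi>]) \<longleftrightarrow> lae_proof T \<Phi>s \<and> (\<Phi> \<in> T \<or> lae_step (set \<Phi>s) \<Phi>)"
  by (auto simp: lae_proof_def nth_append all_conj_distrib less_Suc_eq)

lemma lae_proof_append:
  assumes "lae_proof T \<Phi>s" and "lae_proof T \<Psi>s"
  shows "lae_proof T (\<Phi>s @ \<Psi>s)"
  using assms(2)
proof (induction \<Psi>s rule: rev_induct)
  case Nil
  then show ?case using assms(1) by simp
next
  case (snoc \<Psi> \<Psi>s)
  then have "lae_proof T (\<Phi>s @ \<Psi>s)" and "\<Psi> \<in> T \<or> lae_step (set (\<Phi>s @ \<Psi>s)) \<Psi>"
    by (auto simp: lae_proof_snoc intro: lae_step_mono)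
  then have "lae_proof T ((\<Phi>s @ \<Psi>s) @ [\<Psi>])" by (simp only: lae_proof_snoc)
  then show ?case by simp
qed

lemma lae_proof_of_finite_set:
  assumes "finite P" and "\<And>\<Phi>. \<Phi> \<in> P \<Longrightarrow> T \<turnstile> \<Phi>"
  shows "\<exists>\<Phi>s. lae_proof T \<Phi>s \<and> P \<subseteq> set \<Phi>s"
  using assms
proof (induction P)
  case empty
  show ?case using lae_proof_Nil by blast
next
  case (insert \<Phi> P)
  then obtain \<Phi>s where "lae_proof T \<Phi>s" and "P \<subseteq> set \<Phi>s" by auto
  moreover obtain \<Psi>s where "lae_proof T \<Psi>s" and "\<Phi> \<in> set \<Psi>s"
    using insert.prems[of \<Phi>] by (auto simp: lae_proves_def)
  ultimately show ?case
    by (intro exI[of _ "\<Phi>s @ \<Psi>s"]) (auto intro: lae_proof_append)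
qed

lemma lae_proves_snoc:
  assumes "lae_proof T \<Phi>s" and "\<Phi> \<in> T \<or> lae_step (set \<Phi>s) \<Phi>"
  shows "T \<turnstile> \<Phi>"
  unfolding lae_proves_def
  by (intro exI[of _ "\<Phi>s @ [\<Phi>]"]) (use assms in \<open>simp add: lae_proof_snoc\<close>)

lemma lae_proves_member: "\<Phi> \<in> T \<Longrightarrow> T \<turnstile> \<Phi>"
  using lae_proves_snoc[OF lae_proof_Nil] by blast

lemma lae_proves_closed_under_lae_step:
  assumes "lae_step {\<Psi>. T \<turnstile> \<Psi>} \<Phi>"
  shows "T \<turnstile> \<Phi>"
proof -
  obtain P where P: "finite P" "P \<subseteq> {\<Psi>. T \<turnstile> \<Psi>}" and "lae_step P \<Phi>"
    using assms by (rule lae_step_finitary)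
  moreover obtain \<Phi>s where "lae_proof T \<Phi>s" and "P \<subseteq> set \<Phi>s"
    using lae_proof_of_finite_set[of P T] P by blast
  ultimately show ?thesis using lae_proves_snoc lae_step_mono by blast
qed

lemma lae_proves_entails: "\<alpha> \<Turnstile> \<beta> \<Longrightarrow> T \<turnstile> (\<alpha> \<Rightarrow>[0] \<beta>)"
  by (intro lae_proves_closed_under_lae_step R1) (simp only: tautology_Imp_iff)

lemma lae_proves_And:
  "T \<turnstile> (\<alpha> \<Rightarrow>[0] \<beta>) \<Longrightarrow> T \<turnstile> (And \<alpha> \<gamma> \<Rightarrow>[0] And \<beta> \<gamma>)"
  by (intro lae_proves_closed_under_lae_step R2) simp

lemma lae_proves_weaken:
  "T \<turnstile> (\<alpha> \<Rightarrow>[c] \<beta>) \<Longrightarrow> 0 \<le> c \<Longrightarrow> c \<le> d \<Longrightarrow> T \<turnstile> (\<alpha> \<Rightarrow>[d] \<beta>)"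
  by (rule lae_proves_closed_under_lae_step, rule R3) simp_all

lemma lae_proves_Bot:
  "T \<turnstile> (\<alpha> \<Rightarrow>[c] Bot) \<Longrightarrow> 0 \<le> c \<Longrightarrow> T \<turnstile> (\<alpha> \<Rightarrow>[0] Bot)"
  by (rule lae_proves_closed_under_lae_step, rule R4) simp_all

lemma lae_proves_Or:
  "T \<turnstile> (\<alpha> \<Rightarrow>[c] \<gamma>) \<Longrightarrow> T \<turnstile> (\<beta> \<Rightarrow>[c] \<gamma>) \<Longrightarrow> 0 \<le> c \<Longrightarrow> T \<turnstile> (Or \<alpha> \<beta> \<Rightarrow>[c] \<gamma>)"
  by (rule lae_proves_closed_under_lae_step, rule R5) simp_all

lemma lae_proves_trans:
  "T \<turnstile> (\<alpha> \<Rightarrow>[c] \<beta>) \<Longrightarrow> T \<turnstile> (\<beta> \<Rightarrow>[d] \<gamma>) \<Longrightarrow> 0 \<le> c \<Longrightarrow> 0 \<le> d \<Longrightarrow> T \<turnstile> (\<alpha> \<Rightarrow>[c + d] \<gamma>)"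
  by (rule lae_proves_closed_under_lae_step, rule R6) simp_all

lemma lae_proves_mono:
  assumes "\<alpha>' \<Turnstile> \<alpha>" and "T \<turnstile> (\<alpha> \<Rightarrow>[c] \<beta>)" and "\<beta> \<Turnstile> \<beta>'" and "0 \<le> c"
  shows "T \<turnstile> (\<alpha>' \<Rightarrow>[c] \<beta>')"
proof -
  have "T \<turnstile> (\<alpha>' \<Rightarrow>[0 + c] \<beta>)"
    using lae_proves_trans[OF lae_proves_entails[OF assms(1)] assms(2)] assms(4) by simp
  then have "T \<turnstile> (\<alpha>' \<Rightarrow>[0 + c + 0] \<beta>')"
    using lae_proves_trans[OF _ lae_proves_entails[OF assms(3)]] assms(4) by simp
  then show ?thesis by simp
qed

section \<open>Signed degrees\<close>

primrec lae_proves_signed :: "gimp set \<Rightarrow> gimp \<Rightarrow> bool"  (infix \<open>\<tturnstile>\<close> 50) where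
  "T \<tturnstile> (\<alpha> \<Rightarrow>[r] \<beta>) \<longleftrightarrow> T \<turnstile> (if 0 \<le> r then \<alpha> \<Rightarrow>[r] \<beta> else \<alpha> \<Rightarrow>[0] Bot)"

lemma lae_proves_signed_refutable:
  assumes "T \<turnstile> (\<alpha> \<Rightarrow>[0] Bot)"
  shows "T \<tturnstile> (\<alpha> \<Rightarrow>[r] \<beta>)"
proof (cases "0 \<le> r")
  case True
  have "T \<turnstile> (\<alpha> \<Rightarrow>[0] \<beta>)"
    by (rule lae_proves_mono[OF entails_refl assms]) (simp_all add: entails_def)
  then show ?thesis using True by (simp add: lae_proves_weaken)
next
  case False
  then show ?thesis using assms by simp
qed

lemma lae_proves_signed_trans:
  assumes "T \<turnstile> (\<alpha> \<Rightarrow>[c] \<beta>)" and "0 \<le> c" and "T \<tturnstile> (\<beta> \<Rightarrow>[r] \<gamma>)"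
  shows "T \<tturnstile> (\<alpha> \<Rightarrow>[c + r] \<gamma>)"
proof (cases "0 \<le> r")
  case True
  then show ?thesis using assms lae_proves_trans by simp
next
  case False
  then have "T \<turnstile> (\<alpha> \<Rightarrow>[c + 0] Bot)"
    using lae_proves_trans[OF assms(1), of 0 Bot] assms(2,3) by simp
  then have "T \<turnstile> (\<alpha> \<Rightarrow>[0] Bot)" using lae_proves_Bot assms(2) by simp
  then show ?thesis by (rule lae_proves_signed_refutable)
qed

lemma lae_proves_signed_big_or:
  assumes "\<And>\<alpha>. \<alpha> \<in> set \<alpha>s \<Longrightarrow> T \<tturnstile> (\<alpha> \<Rightarrow>[r] \<beta>)"
  shows "T \<tturnstile> (big_or \<alpha>s \<Rightarrow>[r] \<beta>)"
  using assms
proof (induction \<alpha>s rule: big_or.induct)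
  case 1
  show ?case
    using lae_proves_signed_refutable[OF lae_proves_entails[OF entails_refl]] by simp
next
  case (2 \<alpha>)
  then show ?case by simp
next
  case (3 \<alpha> \<alpha>' \<alpha>s)
  then have "T \<tturnstile> (\<alpha> \<Rightarrow>[r] \<beta>)" and "T \<tturnstile> (big_or (\<alpha>' # \<alpha>s) \<Rightarrow>[r] \<beta>)" by simp_all
  then show ?case by (simp add: lae_proves_Or split: if_splits)
qed

section \<open>Soundness of the inferences of a proof forest\<close>

definition labels_form :: "label list \<Rightarrow> form" where
  "labels_form as = big_or [clause_form K. Clause K \<leftarrow> as]"

lemma holds_labels_form:
  "holds v (labels_form as) \<longleftrightarrow> (\<exists>K. Clause K \<in> set as \<and> holds v (clause_form K))"
  by (auto simp: labels_form_def split: label.splits)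

lemma lae_proves_signed_labels_form:
  assumes "\<And>K. Clause K \<in> set as \<Longrightarrow> T \<tturnstile> (clause_form K \<Rightarrow>[r] \<beta>)"
  shows "T \<tturnstile> (labels_form as \<Rightarrow>[r] \<beta>)"
  unfolding labels_form_def
  by (rule lae_proves_signed_big_or)
    (use assms in \<open>auto simp del: lae_proves_signed.simps split: label.splits\<close>)

lemma literal_cases_entail_labels_form:
  assumes "finite L" and "\<And>K. Clause K \<in> set as \<Longrightarrow> finite K"
    and "\<And>ms. ms \<in> set mss \<Longrightarrow> \<exists>K. Clause K \<in> set as \<and> K \<subseteq> set ms \<union> L"
  shows "And (big_or (map literals_form mss)) (clause_form L) \<Turnstile> labels_form as"
  unfolding entails_def
proof (intro allI impI)
  fix v assume v: "holds v (And (big_or (map literals_form mss)) (clause_form L))"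
  then obtain ms where "ms \<in> set mss" and ms: "holds v (literals_form ms)" by auto
  then obtain K where K: "Clause K \<in> set as" "K \<subseteq> set ms \<union> L"
    using assms(3) by blast
  then have "holds v (clause_form K)"
    using v ms assms(1,2) by (auto simp: holds_clause_form)
  then show "holds v (labels_form as)" using K(1) holds_labels_form by blast
qed

lemma case_A_sound:
  assumes "case_A T L c es" and "finite L"
    and "\<And>K. Clause K \<in> set (child_labels es) \<Longrightarrow> finite K"
  shows "T \<turnstile> (clause_form L \<Rightarrow>[c] labels_form (child_labels es))"
proof -
  obtain ls mss where "c = 0" and ax: "basic_gimp ls 0 mss \<in> T" and ls: "set ls \<subseteq> L"
    and mss: "\<And>ms. ms \<in> set mss \<Longrightarrow> \<exists>K. Clause K \<in> set (child_labels es) \<and> K \<subseteq> set ms \<union> L"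
    using assms(1) unfolding case_A_def by blast
  have "clause_form L \<Turnstile> And (literals_form ls) (clause_form L)"
    using clause_form_entails_literals[OF assms(2) ls] by (simp add: entails_def)
  moreover have "T \<turnstile> (And (literals_form ls) (clause_form L)
      \<Rightarrow>[0] And (big_or (map literals_form mss)) (clause_form L))"
    using lae_proves_And[OF lae_proves_member[OF ax, unfolded basic_gimp_def]] .
  moreover have "And (big_or (map literals_form mss)) (clause_form L)
      \<Turnstile> labels_form (child_labels es)"
    by (rule literal_cases_entail_labels_form[OF assms(2,3) mss])
  ultimately show ?thesis using \<open>c = 0\<close> lae_proves_mono by blast
qed

lemma case_B_sound:
  assumes "case_B T L c es" and "finite L"
    and "\<And>K. Clause K \<in> set (child_labels es) \<Longrightarrow> finite K"
  shows "T \<turnstile> (clause_form L \<Rightarrow>[c] labels_form (child_labels es))"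
proof -
  obtain ls mss where "c > 0" and ax: "basic_gimp ls c mss \<in> T" and ls: "set ls \<subseteq> L"
    and mss: "\<And>ms. ms \<in> set mss \<Longrightarrow> \<exists>K. Clause K \<in> set (child_labels es) \<and> K \<subseteq> set ms"
    using assms(1) unfolding case_B_def by blast
  have "clause_form L \<Turnstile> literals_form ls"
    by (rule clause_form_entails_literals[OF assms(2) ls])
  moreover have "T \<turnstile> (literals_form ls \<Rightarrow>[c] big_or (map literals_form mss))"
    using lae_proves_member[OF ax, unfolded basic_gimp_def] .
  moreover have "big_or (map literals_form mss) \<Turnstile> labels_form (child_labels es)"
    using literal_cases_entail_labels_form[of "{}" "child_labels es" mss] assms(3) mss
    by (simp add: entails_def holds_clause_form)
  ultimately show ?thesis using \<open>c > 0\<close> lae_proves_mono less_imp_le by blast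
qed

lemma case_C_sound:
  assumes "case_C L c es" and "finite L"
  shows "T \<turnstile> (clause_form L \<Rightarrow>[c] labels_form (child_labels es))"
  using assms inconsistent_clause_form_entails[of L]
  by (auto simp: case_C_def intro: lae_proves_entails)

lemma case_D_sound:
  assumes "case_D L c es" and "finite L"
  shows "T \<turnstile> (clause_form L \<Rightarrow>[c] labels_form (child_labels es))"
proof -
  obtain p S1 S2 where "c = 0" and S: "S1 \<subseteq> L" "S2 \<subseteq> L"
    and children: "Clause (insert (PosL p) S1) \<in> set (child_labels es)"
      "Clause (insert (NegL p) S2) \<in> set (child_labels es)"
    using assms(1) unfolding case_D_def by (metis list.set_intros)
  have "clause_form L \<Turnstile> labels_form (child_labels es)"
    unfolding entails_def
  proof (intro allI impI)
    fix v assume v: "holds v (clause_form L)"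
    have fin: "finite S1" "finite S2" using S assms(2) by (auto intro: finite_subset)
    have "holds v (clause_form (insert (PosL p) S1)) \<or> holds v (clause_form (insert (NegL p) S2))"
      using v S fin assms(2) by (auto simp: holds_clause_form)
    then show "holds v (labels_form (child_labels es))"
      using children holds_labels_form by blast
  qed
  then show ?thesis using \<open>c = 0\<close> lae_proves_entails by simp
qed

definition inference :: "gimp set \<Rightarrow> clause \<Rightarrow> real \<Rightarrow> (real \<times> ptree) list \<Rightarrow> bool" where
  "inference T L c es \<longleftrightarrow> case_A T L c es \<or> case_B T L c es \<or> case_C L c es \<or> case_D L c es"

lemma inference_weight_nonneg: "inference T L c es \<Longrightarrow> 0 \<le> c"
  by (auto simp: inference_def case_A_def case_B_def case_C_def case_D_def)

lemma inference_sound: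
  assumes "inference T L c es" and "finite L"
    and "\<And>K. Clause K \<in> set (child_labels es) \<Longrightarrow> finite K"
  shows "T \<turnstile> (clause_form L \<Rightarrow>[c] labels_form (child_labels es))"
  using assms case_A_sound case_B_sound case_C_sound case_D_sound
  unfolding inference_def by metis

lemma inference_proves_signed:
  assumes "inference T L c es" and "finite L"
    and "\<And>K. Clause K \<in> set (child_labels es) \<Longrightarrow> finite K"
    and "\<And>K. Clause K \<in> set (child_labels es) \<Longrightarrow> T \<tturnstile> (clause_form K \<Rightarrow>[r - c] \<eta>)"
  shows "T \<tturnstile> (clause_form L \<Rightarrow>[r] \<eta>)"
proof -
  have "T \<turnstile> (clause_form L \<Rightarrow>[c] labels_form (child_labels es))"
    by (rule inference_sound[OF assms(1-3)])
  moreover have "T \<tturnstile> (labels_form (child_labels es) \<Rightarrow>[r - c] \<eta>)"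
    by (rule lae_proves_signed_labels_form[OF assms(4)])
  ultimately have "T \<tturnstile> (clause_form L \<Rightarrow>[c + (r - c)] \<eta>)"
    using inference_weight_nonneg[OF assms(1)] by (intro lae_proves_signed_trans)
  then show ?thesis by simp
qed

section \<open>Proof trees\<close>

definition star_free_length_le :: "ptree \<Rightarrow> real \<Rightarrow> bool" where
  "star_free_length_le t r \<longleftrightarrow>
     (\<forall>(as, ws)\<in>set (tree_branches t). Star \<notin> set as \<longrightarrow> sum_list ws \<le> r)"

lemma star_free_length_le_leaf: "star_free_length_le (Node (Clause L) []) r \<longleftrightarrow> 0 \<le> r"
  by (simp add: star_free_length_le_def)

lemma star_free_length_le_child:
  assumes "star_free_length_le (Node (Clause L) es) r" and "(w, t) \<in> set es"
  shows "star_free_length_le t (r - w)"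
  unfolding star_free_length_le_def
proof (clarify)
  fix as ws assume "(as, ws) \<in> set (tree_branches t)" and "Star \<notin> set as"
  moreover from this assms(2)
  have "(Clause L # as, w # ws) \<in> set (tree_branches (Node (Clause L) es))" by force
  ultimately have "sum_list (w # ws) \<le> r"
    using assms(1) unfolding star_free_length_le_def by fastforce
  then show "sum_list ws \<le> r - w" by simp
qed

lemma star_free_length_le_forest_length:
  assumes "t \<in> set F" and "forest_length F \<le> r"
  shows "star_free_length_le t r"
  unfolding star_free_length_le_def
proof (clarify)
  fix as ws assume "(as, ws) \<in> set (tree_branches t)" and "Star \<notin> set as"
  then have "sum_list ws \<in> branch_length ` (\<Union>t\<in>set F. set (tree_branches t))"
    using assms(1) by (force simp: branch_length_def)
  then have "sum_list ws \<le> forest_length F"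
    unfolding forest_length_def by (intro Max_ge) auto
  then show "sum_list ws \<le> r" using assms(2) by simp
qed

definition justified :: "gimp set \<Rightarrow> form \<Rightarrow> clause \<Rightarrow> (real \<times> ptree) list \<Rightarrow> bool" where
  "justified T \<eta> L es \<longleftrightarrow>
     finite L \<and>
     (if es = [] then clause_form L \<Turnstile> \<eta>
      else \<exists>c. (\<forall>(w, t)\<in>set es. w = c) \<and> inference T L c es)"

definition proof_tree :: "gimp set \<Rightarrow> form \<Rightarrow> ptree \<Rightarrow> bool" where
  "proof_tree T \<eta> t \<longleftrightarrow>
     (\<forall>L es. Node (Clause L) es \<in> tree_nodes t \<longrightarrow> justified T \<eta> L es)"

lemma proof_tree_root: "proof_tree T \<eta> (Node (Clause L) es) \<Longrightarrow> justified T \<eta> L es"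
  by (simp add: proof_tree_def)

lemma proof_tree_root_finite: "proof_tree T \<eta> t \<Longrightarrow> root_label t = Clause L \<Longrightarrow> finite L"
  by (cases t) (auto dest: proof_tree_root simp: justified_def)

lemma proof_tree_child:
  assumes "proof_tree T \<eta> (Node a es)" and "(w, t) \<in> set es"
  shows "proof_tree T \<eta> t"
proof -
  have "tree_nodes t \<subseteq> tree_nodes (Node a es)" using assms(2) by force
  then show ?thesis using assms(1) unfolding proof_tree_def by blast
qed

theorem proof_tree_sound:
  assumes "proof_tree T \<eta> t" and "star_free_length_le t r" and "root_label t = Clause L"
  shows "T \<tturnstile> (clause_form L \<Rightarrow>[r] \<eta>)"
  using assms
proof (induction t arbitrary: L r)
  case (Node a es)
  then have tree: "proof_tree T \<eta> (Node (Clause L) es)"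
    and length: "star_free_length_le (Node (Clause L) es) r" by simp_all
  have root: "justified T \<eta> L es" by (rule proof_tree_root[OF tree])
  show ?case
  proof (cases "es = []")
    case True
    then have "T \<turnstile> (clause_form L \<Rightarrow>[0] \<eta>)" and "0 \<le> r"
      using root length
      by (auto simp: justified_def star_free_length_le_leaf intro: lae_proves_entails)
    then show ?thesis by (simp add: lae_proves_weaken)
  next
    case False
    then obtain c where weight: "\<forall>(w, t)\<in>set es. w = c" and inference: "inference T L c es"
      using root unfolding justified_def by auto
    have child: "finite K \<and> T \<tturnstile> (clause_form K \<Rightarrow>[r - c] \<eta>)"
      if member: "Clause K \<in> set (child_labels es)" for K
    proof -
      obtain w t where t: "(w, t) \<in> set es" and K: "root_label t = Clause K"
        using member by auto
      have "w = c" using weight t by blast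
      then have bound: "star_free_length_le t (r - c)"
        using star_free_length_le_child[OF length t] by simp
      have subtree: "proof_tree T \<eta> t" by (rule proof_tree_child[OF tree t])
      have "T \<tturnstile> (clause_form K \<Rightarrow>[r - c] \<eta>)"
        using Node.IH[OF t _ subtree bound K] by simp
      then show ?thesis using proof_tree_root_finite[OF subtree K] by blast
    qed
    have "finite L" using root by (simp add: justified_def)
    then show ?thesis using inference_proves_signed[OF inference] child by blast
  qed
qed

section \<open>Forest proofs\<close>

lemma forest_proof_entails_roots:
  assumes "forest_proof T \<zeta> r \<eta> F"
  shows "\<zeta> \<Turnstile> labels_form (map root_label F)"
  unfolding entails_def
proof (intro allI impI)
  fix v assume v: "holds v \<zeta>"
  obtain B where B: "clause_set_for B \<zeta>"
    and roots: "\<And>L. L \<in> B \<Longrightarrow> \<exists>K. Clause K \<in> root_label ` set F \<and> K \<subseteq> L"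
    using assms unfolding forest_proof_def by (elim conjE exE) auto
  obtain L where "L \<in> B" and "holds v (clause_form L)"
    using v holds_iff_clause_set_for[OF B] by blast
  moreover from this have "finite L" using clause_set_for_finite[OF B] by blast
  moreover from calculation obtain K where "Clause K \<in> root_label ` set F" and "K \<subseteq> L"
    using roots by blast
  ultimately show "holds v (labels_form (map root_label F))"
    using clause_form_entails_subset[of L K] unfolding holds_labels_form entails_def by auto
qed

lemma forest_proof_leaf_entails:
  assumes "forest_proof T \<zeta> r \<eta> F" and "Node (Clause L) [] \<in> forest_nodes F" and "finite L"
  shows "clause_form L \<Turnstile> \<eta>"
proof -
  obtain B where B: "clause_set_for B \<eta>"
    and "\<And>L. Node (Clause L) [] \<in> forest_nodes F \<Longrightarrow> \<exists>K\<in>B. K \<subseteq> L"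
    using assms(1) unfolding forest_proof_def by (elim conjE exE) auto
  then obtain K where "K \<in> B" and "K \<subseteq> L" using assms(2) by blast
  then show ?thesis
    using clause_form_entails_subset[OF assms(3)] holds_iff_clause_set_for[OF B]
    unfolding entails_def by blast
qed

lemma forest_proof_justified:
  assumes "forest_proof T \<zeta> r \<eta> F" and node: "Node (Clause L) es \<in> forest_nodes F"
  shows "justified T \<eta> L es"
proof -
  have fin: "finite L"
    using assms unfolding forest_proof_def proof_forest_def is_clause_def by blast
  show ?thesis
  proof (cases "es = []")
    case True
    then show ?thesis
      using forest_proof_leaf_entails[OF assms(1) _ fin] node fin by (simp add: justified_def)
  next
    case False
    then have "\<exists>c. (\<forall>(w, t)\<in>set es. w = c) \<and> inference T L c es"
      using assms unfolding forest_proof_def inference_def by blast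
    then show ?thesis using False fin by (simp add: justified_def)
  qed
qed

lemma forest_proof_proof_tree:
  assumes "forest_proof T \<zeta> r \<eta> F" and "t \<in> set F"
  shows "proof_tree T \<eta> t"
  using assms forest_proof_justified unfolding proof_tree_def forest_nodes_def by blast

theorem theorem3p7:
  fixes T :: "gimp set" and \<zeta> \<eta> :: form and r :: real
  assumes "basic_theory T"
    and "0 \<le> r"
    and "\<exists>F. forest_proof T \<zeta> r \<eta> F"
  shows "T \<turnstile> (\<zeta> \<Rightarrow>[r] \<eta>)"
proof -
  obtain F where F: "forest_proof T \<zeta> r \<eta> F" using assms(3) ..
  then have length: "forest_length F \<le> r" by (simp add: forest_proof_def)
  have "T \<turnstile> (\<zeta> \<Rightarrow>[0] labels_form (map root_label F))"
    by (rule lae_proves_entails[OF forest_proof_entails_roots[OF F]])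
  moreover have "T \<tturnstile> (labels_form (map root_label F) \<Rightarrow>[r] \<eta>)"
  proof (rule lae_proves_signed_labels_form)
    fix K assume "Clause K \<in> set (map root_label F)"
    then obtain t where t: "t \<in> set F" and "root_label t = Clause K" by auto
    then show "T \<tturnstile> (clause_form K \<Rightarrow>[r] \<eta>)"
      using proof_tree_sound[OF forest_proof_proof_tree[OF F t]
          star_free_length_le_forest_length[OF t length]] by blast
  qed
  ultimately have "T \<tturnstile> (\<zeta> \<Rightarrow>[0 + r] \<eta>)" by (intro lae_proves_signed_trans) simp_all
  then show ?thesis using assms(2) by simp
qed

end
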